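(* For all real $\theta$ with $\pi/3 \le \theta \le \pi$ and all positive integers $n$, $$\Delta_{\mathbb{R}^n}^{\rm LP} \leq \sin^n(\theta/2)\, A^{\rm LP}(n,\theta).$$
   Context: Spherical linear program. A function $g\colon[-1,1]\to\mathbb{R}$ is positive definite on $S^{n-1}$ (the unit sphere in $\mathbb{R}^n$) if for all $N$ and all $x_1,\dots,x_N\in S^{n-1}$ the matrix $\big(g(\langle x_i,x_j\rangle)\big)_{1\le i,j\le N}$ is positive semidefinite. For such $g$, $\overline{g}$ denotes the expectation of $g(\langle x,y\rangle)$ with $x,y$ chosen independently and uniformly at random from $S^{n-1}$ (for $n\ge2$ this equals $\int_{-1}^1 g(t)(1-t^2)^{(n-3)/2}\,dt\big/\int_{-1}^1(1-t^2)^{(n-3)/2}\,dt$). Then $A^{\rm LP}(n,\theta)$ is the infimum of $g(1)/\overline{g}$ over all $g\colon[-1,1]\to\mathbb{R}$ that are continuous and positive definite on $S^{n-1}$ and satisfy $g(t)\le0$ for all $t\in[-1,\cos\theta]$ and $\overline{g}>0$. Euclidean linear program. A function $f\colon\mathbb{R}^n\to\mathbb{R}$ is positive definite if for all $N$ and all $x_1,\dots,x_N\in\mathbb{R}^n$ the matrix $\big(f(x_i-x_j)\big)_{1\le i,j\le N}$ is positive semidefinite. For integrable $f$, $\widehat f(0)=\int_{\mathbb{R}^n}f(x)\,dx$. Let $\mathrm{vol}(B_1^n)$ be the volume of the unit ball in $\mathbb{R}^n$. Then $\Delta^{\rm LP}_{\mathbb{R}^n}$ is the infimum of $\mathrm{vol}(B_1^n)\,f(0)/\widehat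 f(0)$ over all $f\colon\mathbb{R}^n\to\mathbb{R}$ that are continuous, positive definite, and integrable and satisfy $f(x)\le0$ for all $|x|\ge2$ and $\widehat f(0)>0$. *)

theory Defs
  imports "HOL-Probability.Probability"
begin

definition pos_semidef :: "nat \<Rightarrow> (nat \<Rightarrow> nat \<Rightarrow> real) \<Rightarrow> bool" where
  "pos_semidef N A \<longleftrightarrow>
     (\<forall>i<N. \<forall>j<N. A i j = A j i) \<and>
     (\<forall>c :: nat \<Rightarrow> real. 0 \<le> (\<Sum>i<N. \<Sum>j<N. c i * c j * A i j))"

(* The uniform probability measure on the unit sphere, as the law of x / |x| for x uniform in the
   unit ball; in dimension 1 it gives mass 1/2 to each of the two points. The point x = 0, where
   sgn x = 0, is a null set. Its space is the sphere itself, so that an integrand only needs to be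
   measurable there. *)
definition unif_sphere :: "'a::euclidean_space measure" where
  "unif_sphere =
     restrict_space (distr (uniform_measure lborel (ball 0 1)) borel sgn) (sphere 0 1)"

lemma space_unif_sphere: "space unif_sphere = sphere (0::'a::euclidean_space) 1"
  by (simp add: unif_sphere_def space_restrict_space)

lemma prob_space_unif_sphere: "prob_space (unif_sphere :: 'a::euclidean_space measure)"
proof
  let ?U = "uniform_measure lborel (ball (0::'a) 1)"
  have nz: "emeasure lborel (ball (0::'a) 1) \<noteq> 0"
    using content_ball_pos[of 1 "0::'a"] by (auto simp: measure_def)
  have fin: "emeasure lborel (ball (0::'a) 1) \<noteq> \<infinity>"
    using emeasure_lborel_ball_finite[of "0::'a" 1] by simp
  have sgn_meas: "(sgn :: 'a \<Rightarrow> 'a) \<in> borel_measurable borel"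
    unfolding sgn_div_norm by measurable
  have vimage: "sgn -` sphere (0::'a) 1 = - {0}"
    by (auto simp: norm_sgn split: if_splits)
  have eq: "emeasure lborel (ball (0::'a) 1 \<inter> - {0}) = emeasure lborel (ball (0::'a) 1)"
    by (rule emeasure_eq_AE) (use AE_lborel_singleton[of "0::'a"] in auto)
  have "emeasure (unif_sphere :: 'a measure) (space unif_sphere)
      = emeasure (distr ?U borel sgn) (sphere 0 1)"
    unfolding space_unif_sphere unfolding unif_sphere_def
    by (rule emeasure_restrict_space) auto
  also have "\<dots> = emeasure ?U (- {0})"
    using sgn_meas vimage by (subst emeasure_distr) auto
  also have "\<dots> = emeasure lborel (ball (0::'a) 1) / emeasure lborel (ball (0::'a) 1)"
    using eq by (subst emeasure_uniform_measure) auto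
  also have "\<dots> = 1"
    using nz fin by (simp add: ennreal_divide_self less_top)
  finally show "emeasure (unif_sphere :: 'a measure) (space unif_sphere) = 1" .
qed

(* Only the values of g on [-1,1] matter: the inner product of two unit vectors lies there. *)
definition pos_def_sphere :: "'a::euclidean_space itself \<Rightarrow> (real \<Rightarrow> real) \<Rightarrow> bool" where
  "pos_def_sphere _ g \<longleftrightarrow>
     (\<forall>N. \<forall>x :: nat \<Rightarrow> 'a. (\<forall>i<N. x i \<in> sphere 0 1) \<longrightarrow>
        pos_semidef N (\<lambda>i j. g (x i \<bullet> x j)))"

definition sphere_mean :: "'a::euclidean_space itself \<Rightarrow> (real \<Rightarrow> real) \<Rightarrow> real" where
  "sphere_mean _ g =
     (\<integral>(x, y). g (x \<bullet> y) \<partial>((unif_sphere :: 'a measure) \<Otimes>\<^sub>M unif_sphere))"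

(* The two bounds are infima in the extended reals, so that the infimum of the empty set would be
   infinity rather than an unspecified real number. *)
definition A_LP :: "'a::euclidean_space itself \<Rightarrow> real \<Rightarrow> ereal" where
  "A_LP T \<theta> = Inf {ereal (g 1 / sphere_mean T g) | g.
     continuous_on {-1..1} g \<and> pos_def_sphere T g \<and>
     (\<forall>t\<in>{-1..cos \<theta>}. g t \<le> 0) \<and> sphere_mean T g > 0}"

definition pos_def :: "('a::euclidean_space \<Rightarrow> real) \<Rightarrow> bool" where
  "pos_def f \<longleftrightarrow> (\<forall>N. \<forall>x :: nat \<Rightarrow> 'a. pos_semidef N (\<lambda>i j. f (x i - x j)))"

definition Delta_LP :: "'a::euclidean_space itself \<Rightarrow> ereal" where
  "Delta_LP _ = Inf {ereal (measure lborel (ball (0::'a) 1) * f 0 / (\<integral>x. f x \<partial>lborel)) | f :: 'a \<Rightarrow> real.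
     continuous_on UNIV f \<and> pos_def f \<and> integrable lborel f \<and>
     (\<forall>x. norm x \<ge> 2 \<longrightarrow> f x \<le> 0) \<and> (\<integral>x. f x \<partial>lborel) > 0}"

end

theory Submission
  imports Defs
begin

text \<open>
  Given \<open>g\<close> feasible for the spherical program, put \<open>R = 1 / sin (\<theta> / 2)\<close> and define \<open>f\<close> by letting
  \<open>f (x - y)\<close> be the integral, over all \<open>z\<close> within distance \<open>R\<close> of both \<open>x\<close> and \<open>y\<close>, of \<open>g\<close> at the
  cosine of the angle \<open>xzy\<close>. Positive definiteness holds for each \<open>z\<close> separately. If
  \<open>\<bar>x - y\<bar> \<ge> 2\<close>, then every such angle is at least \<open>\<theta>\<close>; this is where \<open>\<theta> \<ge> pi / 3\<close>, that is
  \<open>R \<le> 2\<close>, enters. With \<open>V\<close> the volume of the ball of radius \<open>R\<close> and \<open>m\<close> the spherical mean of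
  \<open>g\<close>, one has \<open>f 0 = V * g 1\<close>, and by Fubini the integral of \<open>f\<close> is \<open>V\<^sup>2 * m\<close>.
\<close>

section \<open>Scaling, translation, and integration over the sphere\<close>

lemma integral_lborel_scale:
  fixes f :: "'a::euclidean_space \<Rightarrow> real"
  assumes "f \<in> borel_measurable borel" and "c > 0"
  shows "(\<integral>x. f x \<partial>lborel) = c ^ DIM('a) * (\<integral>x. f (c *\<^sub>R x) \<partial>lborel)"
proof -
  have "(\<integral>x. f x \<partial>lborel)
      = (\<integral>x. f x \<partial>density (distr lborel borel (\<lambda>x::'a. 0 + c *\<^sub>R x)) (\<lambda>_. ennreal (\<bar>c\<bar> ^ DIM('a))))"
    using lborel_affine[of c "0::'a"] assms(2) by simp
  also have "\<dots> = (\<integral>x. c ^ DIM('a) *\<^sub>R f x \<partial>distr lborel borel (\<lambda>x::'a. 0 + c *\<^sub>R x))"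
    using assms by (subst integral_density) auto
  also have "\<dots> = (\<integral>x. c ^ DIM('a) *\<^sub>R f (c *\<^sub>R x) \<partial>lborel)"
    using assms by (subst integral_distr) auto
  finally show ?thesis by simp
qed

lemma integral_lborel_translate:
  fixes f :: "'a::euclidean_space \<Rightarrow> real"
  assumes "f \<in> borel_measurable borel"
  shows "(\<integral>x. f (c + x) \<partial>lborel) = (\<integral>x. f x \<partial>lborel)"
proof -
  have "(\<integral>x. f x \<partial>lborel) = (\<integral>x. f x \<partial>distr lborel borel ((+) c))"
    by (simp add: lborel_distr_plus)
  also have "\<dots> = (\<integral>x. f (c + x) \<partial>lborel)"
    using assms by (subst integral_distr) auto
  finally show ?thesis by simp
qed

text \<open>The sphere measure is the law of \<open>sgn x\<close> for \<open>x\<close> uniform in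
  the unit ball. The radius is free because \<open>sgn\<close> is invariant under positive scaling:
  passing from 1 to \<open>R\<close> multiplies integral and volume by the same power of
  \<open>R\<close>.\<close>

lemma integral_unif_sphere:
  fixes F :: "'a::euclidean_space \<Rightarrow> real"
  assumes [measurable]: "F \<in> borel_measurable borel" and R: "R > 0"
  shows "(\<integral>x. F x \<partial>unif_sphere)
       = (\<integral>x. indicator (ball 0 R - {0}) x * F (sgn x) \<partial>lborel) / measure lborel (ball (0::'a) R)"
proof -
  let ?V = "measure lborel (ball (0::'a) 1)"
  have V: "?V > 0" by simp
  have V': "emeasure lborel (ball (0::'a) 1) = ennreal ?V"
    using emeasure_lborel_ball_finite[of "0::'a" 1] by (intro emeasure_eq_ennreal_measure) auto
  have "(\<integral>x. F x \<partial>unif_sphere)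
     = (\<integral>x. indicator (sphere 0 1) x *\<^sub>R F x \<partial>distr (uniform_measure lborel (ball (0::'a) 1)) borel sgn)"
    unfolding unif_sphere_def by (subst integral_restrict_space) auto
  also have "\<dots> = (\<integral>x. indicator (sphere 0 1) (sgn x) *\<^sub>R F (sgn x) \<partial>uniform_measure lborel (ball (0::'a) 1))"
    by (subst integral_distr) (auto intro!: borel_measurable_times borel_measurable_indicator)
  also have "\<dots> = (\<integral>x. (indicator (ball 0 1) x / ?V) *\<^sub>R (indicator (sphere 0 1) (sgn x) *\<^sub>R F (sgn x)) \<partial>lborel)"
  proof -
    have "uniform_measure lborel (ball (0::'a) 1)
        = density lborel (\<lambda>x. ennreal (indicator (ball 0 1) x / ?V))"
      unfolding uniform_measure_def V'
      using V by (intro density_cong) (auto simp: indicator_def divide_ennreal[symmetric])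
    moreover have "(\<lambda>x::'a. indicator (sphere 0 1) (sgn x) *\<^sub>R F (sgn x)) \<in> borel_measurable lborel"
      by (rule measurable_compose[where N = borel and g = "\<lambda>x. indicator (sphere 0 1) x *\<^sub>R F x"])
         (auto intro!: borel_measurable_times borel_measurable_indicator)
    moreover have "(\<lambda>x::'a. indicator (ball 0 1) x / ?V) \<in> borel_measurable lborel"
      by (auto intro!: borel_measurable_divide borel_measurable_indicator)
    ultimately show ?thesis
      by (simp only:) (rule integral_density, auto)
  qed
  also have "\<dots> = (\<integral>x. indicator (ball 0 1 - {0}) x * F (sgn x) \<partial>lborel) / ?V"
    by (subst Bochner_Integration.integral_divide_zero[symmetric], rule Bochner_Integration.integral_cong)
       (auto simp: indicator_def norm_sgn)
  finally have 1: "(\<integral>x. F x \<partial>unif_sphere)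
      = (\<integral>x. indicator (ball 0 1 - {0}) x * F (sgn x) \<partial>lborel) / ?V" .
  have "(\<integral>x. indicator (ball 0 R - {0}) x * F (sgn x) \<partial>lborel)
      = R ^ DIM('a) * (\<integral>x. indicator (ball 0 R - {0}) (R *\<^sub>R x) * F (sgn (R *\<^sub>R x :: 'a)) \<partial>lborel)"
    using R by (intro integral_lborel_scale borel_measurable_times borel_measurable_indicator) auto
  also have "(\<integral>x. indicator (ball 0 R - {0}) (R *\<^sub>R x) * F (sgn (R *\<^sub>R x :: 'a)) \<partial>lborel)
      = (\<integral>x. indicator (ball 0 1 - {0}) x * F (sgn x) \<partial>lborel)"
    using R by (intro Bochner_Integration.integral_cong) (auto simp: indicator_def sgn_scaleR)
  finally show ?thesis
    using 1 R content_ball_conv_unit_ball[of R "0::'a"] by simp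
qed

section \<open>The kernel and its positive semidefiniteness\<close>

text \<open>
  The origin is removed because \<open>sgn 0 = 0\<close> is not a unit vector: this makes the kernel
  positive semidefinite everywhere, not just almost everywhere.
\<close>

definition radial_kernel :: "real \<Rightarrow> (real \<Rightarrow> real) \<Rightarrow> 'a::euclidean_space \<Rightarrow> 'a \<Rightarrow> real" where
  "radial_kernel R g u v =
     indicator (ball 0 R - {0}) u * indicator (ball 0 R - {0}) v * g (sgn u \<bullet> sgn v)"

definition averaged_kernel :: "real \<Rightarrow> (real \<Rightarrow> real) \<Rightarrow> 'a::euclidean_space \<Rightarrow> real" where
  "averaged_kernel R g x = (\<integral>z. radial_kernel R g (x + z) z \<partial>lborel)"

lemma radial_kernel_commute: "radial_kernel R g u v = radial_kernel R g v u"
  by (simp add: radial_kernel_def inner_commute)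

text \<open>The indicators are absorbed into the coefficients, which leaves the matrix of
  \<open>g\<close> at unit vectors.\<close>

lemma radial_kernel_psd:
  fixes x :: "nat \<Rightarrow> 'a::euclidean_space"
  assumes "pos_def_sphere TYPE('a) g"
  shows "0 \<le> (\<Sum>i<N. \<Sum>j<N. c i * c j * radial_kernel R g (x i) (x j))"
proof -
  obtain e :: 'a where e: "e \<in> Basis" using nonempty_Basis by blast
  define d where "d i = c i * indicator (ball 0 R - {0}) (x i)" for i
  \<comment> \<open>Any unit vector serves when \<open>x i = 0\<close>, because
    \<open>d i = 0\<close> there.\<close>
  define y where "y i = (if x i = 0 then e else sgn (x i))" for i
  have "\<forall>i<N. y i \<in> sphere 0 1"
    using e by (auto simp: y_def norm_sgn)
  then have "0 \<le> (\<Sum>i<N. \<Sum>j<N. d i * d j * g (y i \<bullet> y j))"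
    using assms unfolding pos_def_sphere_def pos_semidef_def by blast
  also have "\<dots> = (\<Sum>i<N. \<Sum>j<N. c i * c j * radial_kernel R g (x i) (x j))"
    by (intro sum.cong refl) (auto simp: d_def y_def radial_kernel_def indicator_def)
  finally show ?thesis .
qed

text \<open>A feasible \<open>g\<close> is continuous only on \<open>[-1,1]\<close>. These
  assumptions are met by its clamped extension, which \<open>Delta_LP_le\<close> substitutes for
  it.\<close>

context
  fixes g :: "real \<Rightarrow> real" and B R :: real
  assumes cont: "continuous_on UNIV g" and bound: "\<And>t. \<bar>g t\<bar> \<le> B" and R: "R > 0"
begin

lemma measurable_g [measurable]: "g \<in> borel_measurable borel"
  using cont by (rule borel_measurable_continuous_onI)

lemma radial_kernel_measurable [measurable (raw)]:
  assumes [measurable]: "u \<in> borel_measurable M" "v \<in> borel_measurable M"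
  shows "(\<lambda>x. radial_kernel R g (u x) (v x :: 'a::euclidean_space)) \<in> borel_measurable M"
proof -
  have ind: "(indicator (ball 0 R - {0}) :: 'a \<Rightarrow> real) \<in> borel_measurable borel"
    by (rule borel_measurable_indicator) auto
  have "(\<lambda>x. g (sgn (u x) \<bullet> sgn (v x))) \<in> borel_measurable M"
    by measurable
  moreover have "(\<lambda>x. indicator (ball 0 R - {0}) (u x) :: real) \<in> borel_measurable M"
    and "(\<lambda>x. indicator (ball 0 R - {0}) (v x) :: real) \<in> borel_measurable M"
    by (rule measurable_compose[OF _ ind], fact)+
  ultimately show ?thesis
    unfolding radial_kernel_def by (intro borel_measurable_times)
qed

lemma norm_radial_kernel_le:
  "norm (radial_kernel R g u v) \<le> B * indicator (ball 0 R) v"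
  using bound[of "sgn u \<bullet> sgn v"] order_trans[OF abs_ge_zero bound]
  by (auto simp: radial_kernel_def indicator_def)

text \<open>The second argument alone confines \<open>z\<close> to a ball of finite measure, where
  the kernel is bounded by \<open>B\<close>; hence \<open>u\<close> need only be measurable. The
  form covers every entry of the matrix in \<open>pos_def_averaged_kernel\<close>.\<close>

lemma integrable_radial_kernel:
  assumes [measurable]: "u \<in> borel_measurable borel"
  shows "integrable lborel (\<lambda>z. radial_kernel R g (u z) (c + z :: 'a::euclidean_space))"
proof (rule integrableI_bounded_set[where A = "ball (-c) R" and B = B])
  show "emeasure lborel (ball (- c) R) < \<infinity>"
    using emeasure_lborel_ball_finite by (simp add: less_top)
  have *: "norm (radial_kernel R g (u z) (c + z)) \<le> B * indicator (ball (-c) R) z" for z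
  proof -
    have "c + z \<in> ball 0 R \<longleftrightarrow> z \<in> ball (-c) R"
      by (simp add: dist_norm norm_minus_commute[of "-c" z] add.commute)
    then show ?thesis
      using norm_radial_kernel_le[of "u z" "c + z"] by (simp add: indicator_def)
  qed
  show "AE z in lborel. z \<in> ball (-c) R \<longrightarrow> norm (radial_kernel R g (u z) (c + z)) \<le> B"
  proof (intro AE_I2 impI)
    fix z assume "z \<in> ball (-c) R"
    then show "norm (radial_kernel R g (u z) (c + z)) \<le> B"
      using *[of z] by (simp del: mem_ball)
  qed
  show "AE z in lborel. z \<notin> ball (-c) R \<longrightarrow> radial_kernel R g (u z) (c + z) = 0"
  proof (intro AE_I2 impI)
    fix z assume "z \<notin> ball (-c) R"
    then show "radial_kernel R g (u z) (c + z) = 0"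
      using *[of z] by (simp del: mem_ball)
  qed
qed auto

section \<open>Positive definiteness and continuity of the averaged kernel\<close>

text \<open>Translating \<open>z\<close> by \<open>y\<close> gives the form that is symmetric in
  \<open>x\<close> and \<open>y\<close>; the vertex of the angle is then \<open>-z\<close>.\<close>

lemma averaged_kernel_diff:
  "averaged_kernel R g (x - y) = (\<integral>z. radial_kernel R g (x + z) (y + z :: 'a::euclidean_space) \<partial>lborel)"
  using integral_lborel_translate[of "\<lambda>z. radial_kernel R g (x - y + z) z" y]
  by (simp add: averaged_kernel_def algebra_simps)

lemma pos_def_averaged_kernel:
  assumes "pos_def_sphere TYPE('a::euclidean_space) g"
  shows "pos_def (averaged_kernel R g :: 'a \<Rightarrow> real)"
  unfolding pos_def_def pos_semidef_def
proof (intro allI conjI impI)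
  fix N :: nat and x :: "nat \<Rightarrow> 'a" and i j
  show "averaged_kernel R g (x i - x j) = averaged_kernel R g (x j - x i)"
    by (simp add: averaged_kernel_diff radial_kernel_commute)
next
  fix N :: nat and x :: "nat \<Rightarrow> 'a" and c :: "nat \<Rightarrow> real"
  have "(\<Sum>i<N. \<Sum>j<N. c i * c j * averaged_kernel R g (x i - x j))
      = (\<integral>z. (\<Sum>i<N. \<Sum>j<N. c i * c j * radial_kernel R g (x i + z) (x j + z)) \<partial>lborel)"
    by (simp add: averaged_kernel_diff integrable_radial_kernel)
  also have "\<dots> \<ge> 0"
    by (intro Bochner_Integration.integral_nonneg radial_kernel_psd assms)
  finally show "0 \<le> (\<Sum>i<N. \<Sum>j<N. c i * c j * averaged_kernel R g (x i - x j))" .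
qed

text \<open>Away from the origin and the sphere of radius \<open>R\<close> the indicator is locally
  constant and \<open>sgn\<close> is continuous.\<close>

lemma tendsto_radial_kernel:
  fixes v :: "'a::euclidean_space"
  assumes "u \<noteq> 0" "norm u \<noteq> R" and lim: "(f \<longlongrightarrow> u) F"
  shows "((\<lambda>n. radial_kernel R g (f n) v) \<longlongrightarrow> radial_kernel R g u v) F"
proof -
  have "((\<lambda>n. indicator (ball 0 R - {0}) (f n) :: real) \<longlongrightarrow> indicator (ball 0 R - {0}) u) F"
  proof (cases "norm u < R")
    case True
    have "\<forall>\<^sub>F n in F. f n \<in> ball 0 R - {0}"
      by (rule topological_tendstoD[OF lim]) (use True assms in auto)
    then show ?thesis
      by (rule tendsto_eventually[OF eventually_mono]) (use True assms in auto)
  next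
    case False
    have "\<forall>\<^sub>F n in F. f n \<in> - cball 0 R"
      by (rule topological_tendstoD[OF lim]) (use False assms in auto)
    then show ?thesis
      by (rule tendsto_eventually[OF eventually_mono]) (use False assms in auto)
  qed
  moreover have "((\<lambda>n. g (sgn (f n) \<bullet> sgn v)) \<longlongrightarrow> g (sgn u \<bullet> sgn v)) F"
    using assms by (intro continuous_on_tendsto_compose[OF cont] tendsto_intros) auto
  ultimately show ?thesis
    unfolding radial_kernel_def by (intro tendsto_intros)
qed

text \<open>Dominated convergence: the exceptional \<open>z\<close> form a null set, namely the
  point \<open>-x\<close> and the sphere of radius \<open>R\<close> about it. The dominating
  function is the same for all \<open>n\<close> because the second argument of the kernel is not
  shifted.\<close>

lemma continuous_averaged_kernel:
  "continuous_on UNIV (averaged_kernel R g :: 'a::euclidean_space \<Rightarrow> real)"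
proof (rule continuous_on_sequentiallyI)
  fix X :: "nat \<Rightarrow> 'a" and x assume X: "X \<longlonglongrightarrow> x"
  have "AE z in lborel. z \<notin> sphere (-x) R"
    using negligible_sphere[of "-x" R]
    by (intro AE_not_in) (auto simp: null_sets_completion_iff negligible_iff_null_sets)
  then have ae: "AE z in lborel. x + z \<noteq> 0 \<and> norm (x + z) \<noteq> R"
    using AE_lborel_singleton[of "-x"]
  proof eventually_elim
    case (elim z)
    then show ?case
      by (auto simp: dist_norm norm_minus_commute add.commute add_eq_0_iff2)
  qed
  show "(\<lambda>n. averaged_kernel R g (X n)) \<longlonglongrightarrow> averaged_kernel R g x"
    unfolding averaged_kernel_def
  proof (rule integral_dominated_convergence)
    show "integrable lborel (\<lambda>z. B * indicator (ball (0::'a) R) z)"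
      using emeasure_lborel_ball_finite[of "0::'a" R] by (simp add: less_top)
    show "AE z in lborel. (\<lambda>n. radial_kernel R g (X n + z) z) \<longlonglongrightarrow> radial_kernel R g (x + z) z"
      using ae by eventually_elim (auto intro!: tendsto_radial_kernel tendsto_intros X)
  qed (use norm_radial_kernel_le in auto)
qed

section \<open>Value at the origin and total integral\<close>

lemma averaged_kernel_0:
  "averaged_kernel R g (0::'a::euclidean_space) = measure lborel (ball (0::'a) R) * g 1"
proof -
  have "averaged_kernel R g (0::'a) = (\<integral>z. indicator (ball (0::'a) R) z * g 1 \<partial>lborel)"
    unfolding averaged_kernel_def
  proof (rule integral_cong_AE)
    show "AE z in lborel. radial_kernel R g (0 + z) z = indicator (ball (0::'a) R) z * g 1"
      using AE_lborel_singleton[of "0::'a"]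
      by eventually_elim (auto simp: radial_kernel_def indicator_def sgn_div_norm dot_square_norm power2_eq_square)
  qed (auto intro!: borel_measurable_times borel_measurable_indicator)
  then show ?thesis by simp
qed

text \<open>If \<open>x + z\<close> and \<open>z\<close> both have norm below \<open>R\<close>, then
  \<open>x\<close> has norm below \<open>2 * R\<close>, so the support has finite measure.\<close>

lemma integrable_radial_kernel_pair:
  "integrable (lborel \<Otimes>\<^sub>M lborel) (\<lambda>(x, z). radial_kernel R g (x + z) (z :: 'a::euclidean_space))"
proof (rule integrableI_bounded_set[where A = "ball 0 (2 * R) \<times> ball 0 R" and B = B])
  have "emeasure (lborel \<Otimes>\<^sub>M lborel) (ball (0::'a) (2 * R) \<times> ball (0::'a) R)
      = emeasure lborel (ball (0::'a) (2 * R)) * emeasure lborel (ball (0::'a) R)"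
    by (subst lborel.emeasure_pair_measure_Times) auto
  also have "\<dots> < \<infinity>"
    using emeasure_lborel_ball_finite[of "0::'a"] by (simp add: ennreal_mult_less_top less_top)
  finally show "emeasure (lborel \<Otimes>\<^sub>M lborel) (ball (0::'a) (2 * R) \<times> ball (0::'a) R) < \<infinity>" .
  have B: "B \<ge> 0" using order_trans[OF abs_ge_zero bound] .
  have "norm (radial_kernel R g u v) \<le> B" for u v :: 'a
    using norm_radial_kernel_le[of u v] B by (cases "v \<in> ball 0 R") auto
  then show "AE p in lborel \<Otimes>\<^sub>M lborel. p \<in> ball 0 (2 * R) \<times> ball 0 R \<longrightarrow>
      norm (case p of (x, z) \<Rightarrow> radial_kernel R g (x + z) (z :: 'a)) \<le> B"
    by auto
  have null: "radial_kernel R g (x + z) z = 0" if "(x, z) \<notin> ball 0 (2 * R) \<times> ball 0 R" for x z :: 'a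
    using that norm_triangle_ineq4[of "x + z" z] by (auto simp: radial_kernel_def indicator_def)
  show "AE p in lborel \<Otimes>\<^sub>M lborel. p \<notin> ball 0 (2 * R) \<times> ball 0 R \<longrightarrow>
      (case p of (x, z) \<Rightarrow> radial_kernel R g (x + z) (z :: 'a)) = 0"
    by (intro AE_I2 impI) (metis (no_types, lifting) null case_prod_beta prod.collapse)
qed auto

lemma integrable_averaged_kernel:
  "integrable lborel (averaged_kernel R g :: 'a::euclidean_space \<Rightarrow> real)"
  using lborel_pair.integrable_fst'[OF integrable_radial_kernel_pair]
  by (simp add: averaged_kernel_def[abs_def])

text \<open>\<open>integral_unif_sphere\<close> is applied to each of the two variables with the
  same radius \<open>R\<close>, which yields the squared volume.\<close>

lemma sphere_mean_eq:
  "sphere_mean TYPE('a::euclidean_space) g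
     = (\<integral>z. \<integral>x. radial_kernel R g x (z :: 'a) \<partial>lborel \<partial>lborel) / (measure lborel (ball (0::'a) R))\<^sup>2"
proof -
  let ?S = "unif_sphere :: 'a measure" and ?V = "measure lborel (ball (0::'a) R)"
  interpret S: prob_space ?S by (rule prob_space_unif_sphere)
  interpret P: pair_prob_space ?S ?S ..
  have [measurable]: "(\<lambda>x. x) \<in> ?S \<rightarrow>\<^sub>M borel"
    by (auto simp: unif_sphere_def intro: measurable_restrict_space1)
  \<comment> \<open>\<open>H\<close> is defined on the whole space and not only on unit vectors, so
    that it is Borel and \<open>integral_unif_sphere\<close> applies to it in turn.\<close>
  define H where "H x = (\<integral>y. indicator (ball 0 R - {0}) y * g (x \<bullet> sgn y) \<partial>lborel)" for x :: 'a
  have ind: "(\<lambda>x. indicator (ball 0 R - {0}) (snd x :: 'a) :: real) \<in> borel_measurable (borel \<Otimes>\<^sub>M lborel)"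
    by (rule measurable_compose[OF _ borel_measurable_indicator[of _ borel]]) auto
  have "(\<lambda>x. g (fst x \<bullet> sgn (snd x :: 'a))) \<in> borel_measurable (borel \<Otimes>\<^sub>M lborel)"
    by measurable
  with ind have "(\<lambda>(x, y). indicator (ball 0 R - {0}) y * g (x \<bullet> sgn (y :: 'a)))
      \<in> borel_measurable (borel \<Otimes>\<^sub>M lborel)"
    unfolding split_beta' by (rule borel_measurable_times)
  then have [measurable]: "H \<in> borel_measurable borel"
    unfolding H_def by (rule lborel.borel_measurable_lebesgue_integral)
  have "integrable (?S \<Otimes>\<^sub>M ?S) (\<lambda>(x, y). g (x \<bullet> y))"
    by (rule P.P.integrable_const_bound[where B = B]) (use bound in auto)
  then have "sphere_mean TYPE('a) g = (\<integral>x. \<integral>y. g (x \<bullet> y) \<partial>?S \<partial>?S)"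
    unfolding sphere_mean_def by (subst P.integral_fst'[symmetric]) auto
  also have "\<dots> = (\<integral>x. H x / ?V \<partial>?S)"
    unfolding H_def by (subst integral_unif_sphere[OF _ R]) auto
  also have "\<dots> = (\<integral>x. indicator (ball 0 R - {0}) x * (H (sgn x) / ?V) \<partial>lborel) / ?V"
    by (subst integral_unif_sphere[OF _ R]) auto
  also have "\<dots> = (\<integral>x. indicator (ball 0 R - {0}) x * H (sgn x) \<partial>lborel) / ?V\<^sup>2"
    by (simp add: power2_eq_square)
  \<comment> \<open>The outer indicator moves inside the inner integral. The outer variable becomes
    \<open>z\<close>, so symmetry of the inner product suffices and the order of integration stays
    the same.\<close>
  also have "(\<integral>x. indicator (ball 0 R - {0}) x * H (sgn x) \<partial>lborel)
      = (\<integral>z. \<integral>x. radial_kernel R g x (z :: 'a) \<partial>lborel \<partial>lborel)"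
    unfolding H_def radial_kernel_def
    by (subst Bochner_Integration.integral_mult_right_zero[symmetric]) (simp add: ac_simps inner_commute)
  finally show ?thesis .
qed

text \<open>After Fubini, translation invariance in \<open>x\<close> for each fixed \<open>z\<close>
  replaces \<open>x + z\<close> by a variable independent of \<open>z\<close>.\<close>

lemma integral_averaged_kernel:
  "(\<integral>x. averaged_kernel R g (x :: 'a::euclidean_space) \<partial>lborel)
     = (measure lborel (ball (0::'a) R))\<^sup>2 * sphere_mean TYPE('a) g"
proof -
  have "(\<integral>x. averaged_kernel R g (x :: 'a) \<partial>lborel)
      = (\<integral>z. \<integral>x. radial_kernel R g (x + z) (z :: 'a) \<partial>lborel \<partial>lborel)"
    using lborel_pair.Fubini_integral[OF integrable_radial_kernel_pair[where 'a = 'a]]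
    by (simp add: averaged_kernel_def)
  also have "\<dots> = (\<integral>z. \<integral>x. radial_kernel R g x (z :: 'a) \<partial>lborel \<partial>lborel)"
  proof (rule Bochner_Integration.integral_cong[OF refl])
    fix z :: 'a
    show "(\<integral>x. radial_kernel R g (x + z) z \<partial>lborel) = (\<integral>x. radial_kernel R g x z \<partial>lborel)"
      using integral_lborel_translate[of "\<lambda>x. radial_kernel R g x z" z] by (simp add: add.commute)
  qed
  finally show ?thesis
    using R by (simp add: sphere_mean_eq)
qed

end

section \<open>The sign condition: triangles with a side of length at least 2\<close>

text \<open>By the law of cosines, \<open>R\<^sup>2 * (1 - c) = 2\<close> says that two sides of
  length \<open>R\<close> enclosing an angle of cosine \<open>c\<close> span a third side of length
  2. With shorter sides and a smaller angle, the third side should stay below 2;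
  \<open>R \<le> 2\<close> makes this true also when the two sides are unequal.\<close>

lemma obtuse_triangle_bound:
  fixes a b :: "'a::euclidean_space"
  assumes a: "0 < norm a" "norm a < R" and b: "0 < norm b" "norm b < R" and dist: "2 \<le> norm (a - b)"
    and R: "R\<^sup>2 * (1 - c) = 2" "R\<^sup>2 \<le> 4"
  shows "sgn a \<bullet> sgn b \<le> c"
proof (rule ccontr)
  define s where "s = sgn a \<bullet> sgn b"
  assume "\<not> sgn a \<bullet> sgn b \<le> c"
  then have s: "c < s" by (simp add: s_def)
  have ab: "a \<bullet> b = norm a * norm b * s"
    using a b by (simp add: s_def sgn_div_norm field_simps)
  have d: "4 \<le> (norm a)\<^sup>2 + (norm b)\<^sup>2 - 2 * (norm a * norm b * s)"
  proof -
    have "2\<^sup>2 \<le> (norm (a - b))\<^sup>2" using dist by (intro power_mono) auto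
    also have "\<dots> = (norm a)\<^sup>2 + (norm b)\<^sup>2 - 2 * (a \<bullet> b)"
      by (simp add: power2_norm_eq_inner inner_diff_left inner_diff_right inner_commute)
    finally show ?thesis by (simp add: ab)
  qed
  have "c < 1" using R(1) by (metis diff_gt_0_iff_gt zero_less_mult_pos zero_less_numeral zero_le_power2 order_le_less mult_zero_left zero_neq_numeral)
  \<comment> \<open>Here \<open>p\<close> is the longer side. As \<open>p\<^sup>2 < 4\<close>, the
    rest \<open>q * (q - 2 * (p * s))\<close> of the squared third side is positive. Raising
    \<open>q\<close> to \<open>p\<close> therefore does not decrease it, and the isosceles case
    gives the contradiction.\<close>
  have key: False if pq: "0 < q" "q \<le> p" "p < R" "4 \<le> p\<^sup>2 + q\<^sup>2 - 2 * (p * q * s)" for p q :: real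
  proof -
    have p2: "p\<^sup>2 < R\<^sup>2" using pq by (intro power_strict_mono) auto
    have "0 < q * (q - 2 * (p * s))" using pq(4) p2 R(2) by (simp add: algebra_simps power2_eq_square)
    then have "0 < q - 2 * (p * s)" using pq(1) by (simp add: zero_less_mult_iff)
    then have "q * (q - 2 * (p * s)) \<le> p * (p - 2 * (p * s))"
      using pq by (intro mult_mono) auto
    then have "4 \<le> 2 * (p\<^sup>2 * (1 - s))" using pq(4) by (simp add: algebra_simps power2_eq_square)
    also have "p\<^sup>2 * (1 - s) \<le> p\<^sup>2 * (1 - c)" using s by (intro mult_left_mono) auto
    also have "p\<^sup>2 * (1 - c) < R\<^sup>2 * (1 - c)" using p2 \<open>c < 1\<close> by simp
    finally show False using R(1) by simp
  qed
  show False
  proof (cases "norm b \<le> norm a")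
    case True then show False using key[of "norm b" "norm a"] a b d by simp
  next
    case False then show False using key[of "norm a" "norm b"] a b d by (simp add: ac_simps)
  qed
qed

lemma inner_unit_vectors_mem:
  fixes x y :: "'a::real_inner"
  assumes "norm x \<le> 1" "norm y \<le> 1"
  shows "x \<bullet> y \<in> {-1..1}"
  using Cauchy_Schwarz_ineq2[of x y] mult_mono[OF assms] by auto

text \<open>The integrand is nonpositive for every \<open>z\<close>, since \<open>x + z\<close> and
  \<open>z\<close> differ by \<open>x\<close>.\<close>

lemma averaged_kernel_nonpos:
  fixes x :: "'a::euclidean_space"
  assumes x: "2 \<le> norm x" and R: "R\<^sup>2 * (1 - c) = 2" "R\<^sup>2 \<le> 4"
    and g: "\<And>t. t \<in> {-1..c} \<Longrightarrow> g t \<le> 0"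
  shows "averaged_kernel R g x \<le> 0"
proof -
  have "radial_kernel R g (x + z) z \<le> 0" for z
  proof (cases "x + z \<in> ball 0 R - {0} \<and> z \<in> ball 0 R - {0}")
    case True
    have "sgn (x + z) \<bullet> sgn z \<le> c"
      by (rule obtuse_triangle_bound[OF _ _ _ _ _ R]) (use True x in auto)
    moreover have "sgn (x + z) \<bullet> sgn z \<in> {-1..1}"
      by (intro inner_unit_vectors_mem) (auto simp: norm_sgn)
    ultimately show ?thesis using g True by (simp add: radial_kernel_def)
  qed (auto simp: radial_kernel_def)
  then have "0 \<le> (\<integral>z. - radial_kernel R g (x + z) z \<partial>lborel)"
    by (intro Bochner_Integration.integral_nonneg) simp
  then show ?thesis by (simp add: averaged_kernel_def)
qed

section \<open>From a spherical solution to a Euclidean one\<close>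

lemma Delta_LP_le:
  fixes g :: "real \<Rightarrow> real"
  assumes \<theta>: "pi / 3 \<le> \<theta>" "\<theta> \<le> pi"
    and cont: "continuous_on {-1..1} g" and pd: "pos_def_sphere TYPE('a::euclidean_space) g"
    and neg: "\<forall>t\<in>{-1..cos \<theta>}. g t \<le> 0" and mean: "sphere_mean TYPE('a) g > 0"
  shows "Delta_LP TYPE('a) \<le> ereal (sin (\<theta> / 2) ^ DIM('a) * (g 1 / sphere_mean TYPE('a) g))"
proof -
  \<comment> \<open>Clamping the argument to \<open>[-1,1]\<close> makes the function continuous and
    bounded on the whole line and keeps its values at inner products of unit vectors.\<close>
  define G where "G = ext_cont g (-1) 1"
  define R where "R = 1 / sin (\<theta> / 2)"
  \<comment> \<open>This is the bound \<open>R \<le> 2\<close>, from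
    \<open>\<theta> / 2 \<ge> pi / 6\<close>.\<close>
  have "1 / 2 \<le> sin (\<theta> / 2)"
    using sin_mono_le_eq[of "pi / 6" "\<theta> / 2"] \<theta> by (simp add: sin_30)
  then have s: "sin (\<theta> / 2) > 0" and R: "R > 0" and "R \<le> 2"
    by (auto simp: R_def field_simps)
  then have R4: "R\<^sup>2 \<le> 4" using power_mono[of R 2 2] by simp
  have R2: "R\<^sup>2 * (1 - cos \<theta>) = 2"
    using s cos_double_sin[of "\<theta> / 2"] by (simp add: R_def field_simps)
  have G: "G t = g t" if "t \<in> {-1..1}" for t
    using that by (simp add: G_def)
  have contG: "continuous_on UNIV G"
    unfolding G_def using cont by (intro continuous_on_ext_cont) simp
  have "bounded (range G)"
    unfolding G_def ext_cont_def using cont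
    by (intro clamp_bounded compact_imp_bounded compact_continuous_image) auto
  then obtain B where B: "\<And>t. \<bar>G t\<bar> \<le> B"
    unfolding bounded_iff by auto
  have pdG: "pos_def_sphere TYPE('a) G"
    unfolding pos_def_sphere_def
  proof (intro allI impI)
    fix N and x :: "nat \<Rightarrow> 'a" assume x: "\<forall>i<N. x i \<in> sphere 0 1"
    then have "G (x i \<bullet> x j) = g (x i \<bullet> x j)" if "i < N" "j < N" for i j
      using that by (intro G inner_unit_vectors_mem) auto
    moreover have "pos_semidef N (\<lambda>i j. g (x i \<bullet> x j))"
      using pd x unfolding pos_def_sphere_def by blast
    ultimately show "pos_semidef N (\<lambda>i j. G (x i \<bullet> x j))"
      by (simp add: pos_semidef_def)
  qed
  \<comment> \<open>The space of \<open>unif_sphere\<close> is the sphere itself, so agreement of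
    \<open>G\<close> and \<open>g\<close> on \<open>[-1,1]\<close> is enough.\<close>
  have meanG: "sphere_mean TYPE('a) G = sphere_mean TYPE('a) g"
    unfolding sphere_mean_def
    by (intro Bochner_Integration.integral_cong refl)
       (auto simp: space_pair_measure space_unif_sphere intro!: G inner_unit_vectors_mem)
  let ?f = "averaged_kernel R G :: 'a \<Rightarrow> real"
  let ?V = "\<lambda>r. measure lborel (ball (0::'a) r)"
  have f0: "?f 0 = ?V R * g 1"
    using averaged_kernel_0[OF contG B R] by (simp add: G)
  have int: "(\<integral>x. ?f x \<partial>lborel) = (?V R)\<^sup>2 * sphere_mean TYPE('a) g"
    using integral_averaged_kernel[OF contG B R, where 'a = 'a] by (simp add: meanG)
  have VR: "?V R > 0" using R by simp
  have "Delta_LP TYPE('a) \<le> ereal (?V 1 * ?f 0 / (\<integral>x. ?f x \<partial>lborel))"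
    unfolding Delta_LP_def
  proof (rule Inf_lower, rule CollectI, rule exI[of _ ?f], intro conjI refl)
    show "continuous_on UNIV ?f" by (rule continuous_averaged_kernel[OF contG B R])
    show "pos_def ?f" by (rule pos_def_averaged_kernel[OF contG B R pdG])
    show "integrable lborel ?f" by (rule integrable_averaged_kernel[OF contG B R])
    have "G t \<le> 0" if "t \<in> {-1..cos \<theta>}" for t
      using neg that order_trans[OF _ cos_le_one, of t \<theta>] by (subst G) auto
    then show "\<forall>x. 2 \<le> norm x \<longrightarrow> ?f x \<le> 0"
      using averaged_kernel_nonpos[OF _ R2 R4] by blast
    show "0 < (\<integral>x. ?f x \<partial>lborel)"
      unfolding int using VR mean by simp
  qed
  \<comment> \<open>One of the two volume factors in the integral cancels against the one in
    \<open>?f 0\<close>; the other remains as a ratio of ball volumes, which is a power of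
    \<open>1 / R\<close>.\<close>
  also have "?V 1 * ?f 0 / (\<integral>x. ?f x \<partial>lborel) = ?V 1 / ?V R * (g 1 / sphere_mean TYPE('a) g)"
    using VR by (simp add: f0 int power2_eq_square)
  also have "?V 1 / ?V R = sin (\<theta> / 2) ^ DIM('a)"
    using R content_ball_conv_unit_ball[of R "0::'a"] by (simp add: R_def power_one_over)
  finally show ?thesis .
qed

theorem theorem3p4:
  fixes \<theta> :: real
  assumes "pi / 3 \<le> \<theta>" and "\<theta> \<le> pi"
  shows "Delta_LP TYPE(real ^ 'n) \<le> ereal (sin (\<theta> / 2) ^ CARD('n)) * A_LP TYPE(real ^ 'n) \<theta>"
proof -
  let ?s = "ereal (sin (\<theta> / 2) ^ CARD('n))"
  have "0 < sin (\<theta> / 2)"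
    using assms pi_gt_zero by (intro sin_gt_zero) linarith+
  then have s: "0 < ?s" "?s \<noteq> \<infinity>" by simp_all
  \<comment> \<open>With the factor on the left, it suffices to bound each element of the set
    defining \<open>A_LP\<close>. The factor is positive and finite, so the division can be undone
    in \<open>ereal\<close> even if that set is empty.\<close>
  have "Delta_LP TYPE(real ^ 'n) / ?s \<le> A_LP TYPE(real ^ 'n) \<theta>"
    unfolding A_LP_def
  proof (rule Inf_greatest, clarify)
    fix g :: "real \<Rightarrow> real"
    assume "continuous_on {-1..1} g" "pos_def_sphere TYPE(real ^ 'n) g"
      "\<forall>t\<in>{-1..cos \<theta>}. g t \<le> 0" "0 < sphere_mean TYPE(real ^ 'n) g"
    from Delta_LP_le[OF assms this]
    show "Delta_LP TYPE(real ^ 'n) / ?s \<le> ereal (g 1 / sphere_mean TYPE(real ^ 'n) g)"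
      using s by (subst ereal_divide_le_pos) auto
  qed
  then show ?thesis
    using s by (simp add: ereal_divide_le_pos)
qed

end
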